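(* Let $(p_t)_{t\ge0}$ be the transition function of the time-continuous process $(X_t)_{t\ge0}$ on $\mathbb{R}^d$ and, for each discretisation parameter $\delta>0$, let $\pi_\delta$ be the transition kernel of the time-discrete Markov chain $(\mathbf{X}_k^\delta)_{k\in\mathbb{N}}$ on $\mathbb{R}^d$ approximating it (see the context). Let $\mathbf{dist}$ be a distance between probability measures on $\mathbb{R}^d$. Assume: (1) (Contractivity of continuous dynamics) There exist $\lambda>0$ and $C<\infty$ such that for all probability measures $\nu,\eta$ on $\mathbb{R}^d$ and $t>0$, $\mathbf{dist}(\nu p_t,\eta p_t)\le Ce^{-\lambda t}\,\mathbf{dist}(\nu,\eta)$. (2) (Local error bound) There exist a constant $\alpha>0$ and a function $\mathbf{M}:\mathcal{P}(\mathbb{R}^d)\to[0,\infty)$ such that for all probability measures $\nu$ on $\mathbb{R}^d$ and any $\delta>0$, $\sup_{l\in\mathbb{N}:\,l\delta\le1}\mathbf{dist}(\nu p_{\delta l},\nu\pi_\delta^l)\le\delta^{\alpha}\mathbf{M}(\nu)$. (3) (Uniform control for approximated dynamics) For all probability measures $\nu$ on $\mathbb{R}^d$ there exists a constant $\mathbf{C}(\nu)<\infty$, independent of $\delta$, such that $\sup_{l\in\mathbb{N}}\mathbf{M}(\nu\pi_\delta^l)\le\mathbf{C}(\nu)$ for all $\delta>0$. Let $\nu$ be a probability measure on $\mathbb{R}^d$. Then there exists $\tilde{\mathbf{C}}<\infty$ such that for all $l\in\mathbb{N}$ and all $\delta>0$ with $\delta^{-1}\in\mathbb{N}$, $$\mathbf{dist}(\nu\pi_\delta^l,\nu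 p_{\delta l})\le\tilde{\mathbf{C}}\,\delta^{\alpha}.$$ Moreover, the constant $\tilde{\mathbf{C}}$ depends on $\lambda$, $C$ and $\mathbf{C}(\nu)$.
   Context: The process $(X_t)_{t\ge0}$ is given by a stochastic differential equation $\mathrm{d}X_t=b(X_t)\,\mathrm{d}t+\Sigma(X_t)\,\mathrm{d}B_t$ with $b:\mathbb{R}^d\to\mathbb{R}^d$, $\Sigma:\mathbb{R}^d\to\mathbb{R}^{d\times d}$ and $B$ a $d$-dimensional standard Brownian motion; it is assumed to be a time-homogeneous Markov process, so $\nu p_sp_t=\nu p_{s+t}$, where $\nu p_t$ is the law at time $t$ of the process with initial law $\nu$. $\nu\pi_\delta^l$ is the law of the chain after $l$ steps when started from $\nu$ (so $\nu\pi_\delta^0=\nu$; $\mathbb{N}$ includes $0$ where used as a number of steps). $\mathcal{P}(\mathbb{R}^d)$ denotes the probability measures on $\mathbb{R}^d$. *)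

theory Defs
  imports "HOL-Probability.Probability"
begin

section \<open>Probability measures and kernels on Euclidean space\<close>

abbreviation prob_measures :: "'a::topological_space measure set" where
  "prob_measures \<equiv> space (prob_algebra borel)"

definition markov_kernel :: "('a::topological_space \<Rightarrow> 'a measure) \<Rightarrow> bool" where
  "markov_kernel K \<longleftrightarrow> K \<in> borel \<rightarrow>\<^sub>M prob_algebra borel"

text \<open>
  A kernel \<open>K\<close> acts on a law \<open>\<nu>\<close> from the right by the monadic bind:
  \<open>(\<nu> K)(A)\<close> is the integral of \<open>K x A\<close> over \<open>\<nu>(dx)\<close>.
\<close>

abbreviation act :: "'a measure \<Rightarrow> ('a \<Rightarrow> 'a measure) \<Rightarrow> 'a measure" where
  "act \<nu> K \<equiv> Giry_Monad.bind \<nu> K"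

definition chain_law :: "('a \<Rightarrow> 'a measure) \<Rightarrow> nat \<Rightarrow> 'a measure \<Rightarrow> 'a measure" where
  "chain_law K l \<nu> = ((\<lambda>\<mu>. act \<mu> K) ^^ l) \<nu>"


section \<open>Brownian motion and the Ito integral\<close>

text \<open>
  Filtrations are indexed by all of \<open>real\<close> because the library locale has no index set; only
  times \<open>t \<ge> 0\<close> are ever used.
\<close>

definition filtered_prob_space :: "'w measure \<Rightarrow> (real \<Rightarrow> 'w measure) \<Rightarrow> bool" where
  "filtered_prob_space M F \<longleftrightarrow>
     prob_space M \<and> filtration (space M) F \<and> (\<forall>t\<ge>0. subalgebra M (F t))"

definition continuous_adapted ::
    "(real \<Rightarrow> 'w measure) \<Rightarrow> (real \<Rightarrow> 'w \<Rightarrow> 'a::topological_space) \<Rightarrow> bool" where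
  "continuous_adapted F X \<longleftrightarrow>
     (\<forall>t\<ge>0. X t \<in> borel_measurable (F t)) \<and>
     (\<forall>\<omega>\<in>space (F 0). continuous_on {0..} (\<lambda>t. X t \<omega>))"

definition brownian_motion ::
    "'w measure \<Rightarrow> (real \<Rightarrow> 'w measure) \<Rightarrow> (real \<Rightarrow> 'w \<Rightarrow> real ^ 'd) \<Rightarrow> bool" where
  "brownian_motion M F B \<longleftrightarrow>
     continuous_adapted F B \<and>
     (AE \<omega> in M. B 0 \<omega> = 0) \<and>
     (\<forall>s t. 0 \<le> s \<and> s < t \<longrightarrow>
        prob_space.indep_set M
          (sets (F s)) (sets (vimage_algebra (space M) (\<lambda>\<omega>. B t \<omega> - B s \<omega>) borel)) \<and>
        distributed M lborel (\<lambda>\<omega>. B t \<omega> - B s \<omega>)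
          (\<lambda>x. ennreal (\<Prod>i\<in>UNIV. normal_density 0 (sqrt (t - s)) (x $ i))))"

text \<open>
  A simple integrand is \<open>\<Sum>i<n. 1_{(\<tau> i, \<tau> (i+1)]} \<xi> i\<close> with deterministic times and
  bounded matrices \<open>\<xi> i\<close> that are known at time \<open>\<tau> i\<close>.
\<close>

definition simple_integrand ::
    "(real \<Rightarrow> 'w measure) \<Rightarrow> nat \<Rightarrow> (nat \<Rightarrow> real) \<Rightarrow> (nat \<Rightarrow> 'w \<Rightarrow> real ^ 'd ^ 'd) \<Rightarrow> bool" where
  "simple_integrand F n \<tau> \<xi> \<longleftrightarrow>
     0 \<le> \<tau> 0 \<and> (\<forall>i<n. \<tau> i < \<tau> (Suc i)) \<and>
     (\<forall>i<n. \<xi> i \<in> borel_measurable (F (\<tau> i)) \<and>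
        (\<exists>K. \<forall>\<omega>\<in>space (F (\<tau> i)). norm (\<xi> i \<omega>) \<le> K))"

definition simple_value ::
    "nat \<Rightarrow> (nat \<Rightarrow> real) \<Rightarrow> (nat \<Rightarrow> 'w \<Rightarrow> real ^ 'd ^ 'd) \<Rightarrow> real \<Rightarrow> 'w \<Rightarrow> real ^ 'd ^ 'd" where
  "simple_value n \<tau> \<xi> s \<omega> =
     (\<Sum>i<n. indicat_real {\<tau> i<..\<tau> (Suc i)} s *\<^sub>R \<xi> i \<omega>)"

definition simple_ito ::
    "(real \<Rightarrow> 'w \<Rightarrow> real ^ 'd) \<Rightarrow> nat \<Rightarrow> (nat \<Rightarrow> real) \<Rightarrow> (nat \<Rightarrow> 'w \<Rightarrow> real ^ 'd ^ 'd) \<Rightarrow>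
     real \<Rightarrow> 'w \<Rightarrow> real ^ 'd" where
  "simple_ito B n \<tau> \<xi> t \<omega> =
     (\<Sum>i<n. \<xi> i \<omega> *v (B (min t (\<tau> (Suc i))) \<omega> - B (min t (\<tau> i)) \<omega>))"

text \<open>
  \<open>Y\<close> is (a version of) the Ito integral of \<open>H\<close> against \<open>B\<close> over \<open>[0, t]\<close>: it is the limit in
  probability of integrals of simple integrands that approximate \<open>H\<close> in the sense that the
  \<open>L\<^sup>2([0, t])\<close>-distance of the paths tends to 0 in probability. The norm on \<open>real ^ 'd ^ 'd\<close>
  is the Frobenius norm.
\<close>

definition ito_integral ::
    "'w measure \<Rightarrow> (real \<Rightarrow> 'w measure) \<Rightarrow> (real \<Rightarrow> 'w \<Rightarrow> real ^ 'd) \<Rightarrow>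
     (real \<Rightarrow> 'w \<Rightarrow> real ^ 'd ^ 'd) \<Rightarrow> real \<Rightarrow> ('w \<Rightarrow> real ^ 'd) \<Rightarrow> bool" where
  "ito_integral M F B H t Y \<longleftrightarrow>
     Y \<in> borel_measurable M \<and>
     (\<exists>n \<tau> \<xi>.
        (\<forall>k. simple_integrand F (n k) (\<tau> k) (\<xi> k)) \<and>
        (\<forall>\<epsilon>>0. (\<lambda>k. measure M {\<omega> \<in> space M.
            (\<integral>\<^sup>+s\<in>{0..t}. ennreal ((norm (simple_value (n k) (\<tau> k) (\<xi> k) s \<omega> - H s \<omega>))\<^sup>2) \<partial>lborel)
              > ennreal \<epsilon>}) \<longlonglongrightarrow> 0) \<and>
        (\<forall>\<epsilon>>0. (\<lambda>k. measure M {\<omega> \<in> space M.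
            norm (simple_ito B (n k) (\<tau> k) (\<xi> k) t \<omega> - Y \<omega>) > \<epsilon>}) \<longlonglongrightarrow> 0))"


section \<open>The process and its transition function\<close>

text \<open>
  Weak solution of \<open>dX = b(X) dt + \<sigma>(X) dB\<close>: the equation is required in its integrated form,
  with the drift and initial value moved to the other side of the stochastic integral.
\<close>

definition sde_solution ::
    "(real ^ 'd \<Rightarrow> real ^ 'd) \<Rightarrow> (real ^ 'd \<Rightarrow> real ^ 'd ^ 'd) \<Rightarrow> 'w measure \<Rightarrow>
     (real \<Rightarrow> 'w measure) \<Rightarrow> (real \<Rightarrow> 'w \<Rightarrow> real ^ 'd) \<Rightarrow> (real \<Rightarrow> 'w \<Rightarrow> real ^ 'd) \<Rightarrow> bool" where
  "sde_solution b \<sigma> M F B X \<longleftrightarrow>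
     filtered_prob_space M F \<and> brownian_motion M F B \<and> continuous_adapted F X \<and>
     b \<in> borel_measurable borel \<and> \<sigma> \<in> borel_measurable borel \<and>
     (\<forall>t\<ge>0. AE \<omega> in M.
        (\<integral>\<^sup>+s\<in>{0..t}. ennreal (norm (b (X s \<omega>)) + (norm (\<sigma> (X s \<omega>)))\<^sup>2) \<partial>lborel) < \<infinity>) \<and>
     (\<forall>t\<ge>0. ito_integral M F B (\<lambda>s \<omega>. \<sigma> (X s \<omega>)) t
        (\<lambda>\<omega>. X t \<omega> - X 0 \<omega> - (LINT s:{0..t}|lborel. b (X s \<omega>))))"

definition natural_filtration ::
    "'w measure \<Rightarrow> (real \<Rightarrow> 'w \<Rightarrow> 'a::topological_space) \<Rightarrow> real \<Rightarrow> 'w measure" where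
  "natural_filtration M X s =
     sigma (space M) (\<Union>u\<in>{0..s}. sets (vimage_algebra (space M) (X u) borel))"

definition markov_process ::
    "(real \<Rightarrow> 'a::topological_space \<Rightarrow> 'a measure) \<Rightarrow> 'w measure \<Rightarrow> (real \<Rightarrow> 'w \<Rightarrow> 'a) \<Rightarrow> bool" where
  "markov_process p M X \<longleftrightarrow>
     (\<forall>s\<ge>0. \<forall>t\<ge>0. \<forall>A\<in>sets borel. AE \<omega> in M.
        real_cond_exp M (natural_filtration M X s) (\<lambda>\<omega>'. indicat_real A (X (s + t) \<omega>')) \<omega>
          = measure (p t (X s \<omega>)) A)"

text \<open>
  \<open>M\<close>, \<open>F\<close>, \<open>B\<close>, \<open>X\<close> are families indexed by the initial law \<open>\<nu>\<close>; all initial laws share the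
  transition function \<open>p\<close>. The case \<open>s = 0\<close> of the Markov property says that the law of
  \<open>X \<nu> t\<close> is \<open>act \<nu> (p t)\<close>, and the general case yields the semigroup property of \<open>p\<close>.
\<close>

definition sde_transition_function ::
    "(real ^ 'd \<Rightarrow> real ^ 'd) \<Rightarrow> (real ^ 'd \<Rightarrow> real ^ 'd ^ 'd) \<Rightarrow>
     ((real ^ 'd) measure \<Rightarrow> 'w measure) \<Rightarrow> ((real ^ 'd) measure \<Rightarrow> real \<Rightarrow> 'w measure) \<Rightarrow>
     ((real ^ 'd) measure \<Rightarrow> real \<Rightarrow> 'w \<Rightarrow> real ^ 'd) \<Rightarrow>
     ((real ^ 'd) measure \<Rightarrow> real \<Rightarrow> 'w \<Rightarrow> real ^ 'd) \<Rightarrow>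
     (real \<Rightarrow> real ^ 'd \<Rightarrow> (real ^ 'd) measure) \<Rightarrow> bool" where
  "sde_transition_function b \<sigma> M F B X p \<longleftrightarrow>
     (\<forall>t\<ge>0. markov_kernel (p t)) \<and>
     (\<forall>\<nu>\<in>prob_measures.
        sde_solution b \<sigma> (M \<nu>) (F \<nu>) (B \<nu>) (X \<nu>) \<and>
        distr (M \<nu>) borel (X \<nu> 0) = \<nu> \<and>
        markov_process p (M \<nu>) (X \<nu>))"


section \<open>The three assumptions\<close>

definition contractive ::
    "('a::topological_space measure \<Rightarrow> 'a measure \<Rightarrow> real) \<Rightarrow> (real \<Rightarrow> 'a \<Rightarrow> 'a measure) \<Rightarrow>
     real \<Rightarrow> real \<Rightarrow> bool" where
  "contractive D p \<kappa> C \<longleftrightarrow>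
     (\<forall>\<nu>\<in>prob_measures. \<forall>\<eta>\<in>prob_measures. \<forall>t>0.
        D (act \<nu> (p t)) (act \<eta> (p t)) \<le> C * exp (- \<kappa> * t) * D \<nu> \<eta>)"

text \<open>
  Suprema are taken in \<open>ereal\<close>, where they are meaningful also for unbounded families.
\<close>

definition local_error_bound ::
    "('a::topological_space measure \<Rightarrow> 'a measure \<Rightarrow> real) \<Rightarrow> (real \<Rightarrow> 'a \<Rightarrow> 'a measure) \<Rightarrow>
     (real \<Rightarrow> 'a \<Rightarrow> 'a measure) \<Rightarrow> real \<Rightarrow> ('a measure \<Rightarrow> real) \<Rightarrow> bool" where
  "local_error_bound D p \<pi> \<alpha> Mf \<longleftrightarrow>
     (\<forall>\<nu>\<in>prob_measures. 0 \<le> Mf \<nu>) \<and>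
     (\<forall>\<nu>\<in>prob_measures. \<forall>\<delta>>0.
        (SUP l\<in>{l::nat. real l * \<delta> \<le> 1}.
           ereal (D (act \<nu> (p (\<delta> * real l))) (chain_law (\<pi> \<delta>) l \<nu>)))
        \<le> ereal (\<delta> powr \<alpha> * Mf \<nu>))"

definition uniform_control ::
    "(real \<Rightarrow> 'a::topological_space \<Rightarrow> 'a measure) \<Rightarrow> ('a measure \<Rightarrow> real) \<Rightarrow>
     ('a measure \<Rightarrow> real) \<Rightarrow> bool" where
  "uniform_control \<pi> Mf Cf \<longleftrightarrow>
     (\<forall>\<nu>\<in>prob_measures. \<forall>\<delta>>0.
        (SUP l::nat. ereal (Mf (chain_law (\<pi> \<delta>) l \<nu>))) \<le> ereal (Cf \<nu>))"

end

theory Submission imports Defs begin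

text \<open>
  Write \<open>N = 1 / \<delta>\<close>. The law \<open>\<nu> \<pi>^(kN)\<close> of the chain at time \<open>k\<close> is turned into
  \<open>\<nu> p_k\<close> by replacing one block of \<open>N\<close> chain steps at a time with one unit of continuous
  time. The error made in the block ending at time \<open>j\<close> is at most \<open>\<delta>^\<alpha> C(\<nu>)\<close>, and the
  remaining time \<open>k - j\<close> of continuous flow damps it by \<open>C exp(-\<kappa> (k - j))\<close>, so the errors
  sum to a geometric series that is bounded uniformly in \<open>k\<close>. Replacing block by block, rather
  than iterating the contraction over unit time, is what makes this work when
  \<open>C exp(-\<kappa>) \<ge> 1\<close>.
\<close>

section \<open>Telescoping errors in an abstract metric space\<close>

lemma (in Metric_space) telescoped_semigroup_error:
  fixes P :: "real \<Rightarrow> 'a \<Rightarrow> 'a" and Q :: "'a \<Rightarrow> 'a"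
  assumes P_closed: "\<And>t x. 0 \<le> t \<Longrightarrow> x \<in> M \<Longrightarrow> P t x \<in> M"
    and P_0: "\<And>x. x \<in> M \<Longrightarrow> P 0 x = x"
    and P_add: "\<And>s t x. 0 \<le> s \<Longrightarrow> 0 \<le> t \<Longrightarrow> x \<in> M \<Longrightarrow> P t (P s x) = P (s + t) x"
    and contr: "\<And>t x y. 0 < t \<Longrightarrow> x \<in> M \<Longrightarrow> y \<in> M \<Longrightarrow> d (P t x) (P t y) \<le> C * exp (- \<kappa> * t) * d x y"
    and "\<kappa> > 0"
    and Q_closed: "\<And>x. x \<in> M \<Longrightarrow> Q x \<in> M"
    and \<delta>: "\<delta> > 0" "\<delta> * real N = 1"
    and x: "x \<in> M"
    and err: "\<And>m n. n \<le> N \<Longrightarrow> d (P (\<delta> * real n) ((Q ^^ m) x)) ((Q ^^ n) ((Q ^^ m) x)) \<le> \<epsilon>"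
  shows "d ((Q ^^ l) x) (P (\<delta> * real l) x) \<le> (1 + max 1 C / (1 - exp (- \<kappa>))) * \<epsilon>"
proof -
  have \<epsilon>: "\<epsilon> \<ge> 0"
    using err[of 0 0] nonneg order_trans by blast
  have orbit: "(Q ^^ n) x \<in> M" for n
    by (induction n) (use x Q_closed in auto)
  \<comment> \<open>\<open>contr\<close> says nothing at time \<open>0\<close>, where the flow is
    the identity and a prefactor of at least \<open>1\<close> is right; hence
    \<open>max 1 C\<close>. Being nonnegative, it can also multiply error bounds.\<close>
  have contr': "d (P t y) (P t z) \<le> max 1 C * exp (- \<kappa> * t) * d y z"
    if "0 \<le> t" "y \<in> M" "z \<in> M" for t y z
  proof (cases "t = 0")
    case True
    then show ?thesis
      using that mult_right_mono[of 1 "max 1 C" "d y z"] by (simp add: P_0)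
  next
    case False
    then have "d (P t y) (P t z) \<le> C * exp (- \<kappa> * t) * d y z"
      using that contr by simp
    also have "\<dots> \<le> max 1 C * exp (- \<kappa> * t) * d y z"
      by (intro mult_right_mono) auto
    finally show ?thesis .
  qed
  \<comment> \<open>The extra time \<open>t\<close> makes the induction on \<open>k\<close> go through, and also absorbs the
    incomplete last block.\<close>
  have blocks: "d (P t ((Q ^^ (k * N)) x)) (P (real k + t) x)
      \<le> max 1 C * \<epsilon> * (\<Sum>j<k. exp (- \<kappa> * (t + real j)))" if "t \<ge> 0" for k t
    using that
  proof (induction k arbitrary: t)
    case 0
    then show ?case using x P_closed by simp
  next
    case (Suc k)
    let ?y = "(Q ^^ (k * N)) x"
    have next_block: "(Q ^^ (Suc k * N)) x = (Q ^^ N) ?y"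
      by (simp add: funpow_add)
    \<comment> \<open>Only the latest block is replaced: from the common start \<open>?y\<close>,
      \<open>N\<close> chain steps are compared with one unit of flow, and the flow over
      \<open>t\<close> damps that error.\<close>
    have "d (P t ((Q ^^ N) ?y)) (P t (P 1 ?y)) \<le> max 1 C * exp (- \<kappa> * t) * d ((Q ^^ N) ?y) (P 1 ?y)"
      using Suc.prems orbit[of "Suc k * N", unfolded next_block] orbit[of "k * N"] P_closed
      by (intro contr') auto
    also have "\<dots> \<le> max 1 C * exp (- \<kappa> * t) * \<epsilon>"
      using err[of N "k * N"] \<delta> by (intro mult_left_mono) (auto simp: commute)
    finally have first: "d (P t ((Q ^^ (Suc k * N)) x)) (P (1 + t) ?y) \<le> max 1 C * \<epsilon> * exp (- \<kappa> * t)"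
      using Suc.prems orbit[of "k * N"] by (simp only: P_add next_block) (simp add: mult_ac)
    \<comment> \<open>The unit of flow just gained joins \<open>t\<close>, so the induction
      hypothesis is used at \<open>1 + t\<close>. This shifts its sum by one index and leaves the
      summand \<open>j = 0\<close> to \<open>first\<close>.\<close>
    have rest: "d (P (1 + t) ?y) (P (real (Suc k) + t) x)
        \<le> max 1 C * \<epsilon> * (\<Sum>j<k. exp (- \<kappa> * (t + real (Suc j))))"
      using Suc.IH[of "1 + t"] Suc.prems by (simp add: algebra_simps)
    have "d (P t ((Q ^^ (Suc k * N)) x)) (P (real (Suc k) + t) x)
        \<le> d (P t ((Q ^^ (Suc k * N)) x)) (P (1 + t) ?y) + d (P (1 + t) ?y) (P (real (Suc k) + t) x)"
      using Suc.prems orbit x by (intro triangle P_closed) auto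
    also have "\<dots> \<le> max 1 C * \<epsilon> * (\<Sum>j<Suc k. exp (- \<kappa> * (t + real j)))"
      using add_mono[OF first rest]
      by (simp only: sum.lessThan_Suc_shift distrib_left) simp
    finally show ?case .
  qed
  define k r where "k = l div N" and "r = l mod N"
  have "N > 0" using \<delta> by (cases N) auto
  \<comment> \<open>The order of the summands in \<open>l(2)\<close> matters:
    \<open>funpow_add\<close> then lets the \<open>k * N\<close> steps of the full blocks come first
    and the \<open>r\<close> leftover steps act on their result.\<close>
  then have r: "r \<le> N" and l: "l = k * N + r" "l = r + k * N"
    by (auto simp: k_def r_def less_imp_le)
  have time: "\<delta> * real l = real k + \<delta> * real r"
    using \<delta>(2) by (simp add: l(1) algebra_simps)
  \<comment> \<open>Bounding \<open>exp (- \<kappa> * t)\<close> by \<open>1\<close> leaves a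
    partial geometric sum with ratio below \<open>1\<close>, so the bound is free of
    \<open>k\<close>.\<close>
  have geom: "(\<Sum>j<k. exp (- \<kappa> * (t + real j))) \<le> 1 / (1 - exp (- \<kappa>))" if "t \<ge> 0" for t
  proof -
    have "(\<Sum>j<k. exp (- \<kappa> * (t + real j))) \<le> (\<Sum>j<k. exp (- \<kappa>) ^ j)"
      using that \<open>\<kappa> > 0\<close> by (intro sum_mono) (simp add: exp_of_nat_mult[symmetric] algebra_simps)
    also have "\<dots> = (1 - exp (- \<kappa>) ^ k) / (1 - exp (- \<kappa>))"
      using \<open>\<kappa> > 0\<close> by (subst sum_gp_strict) auto
    also have "\<dots> \<le> 1 / (1 - exp (- \<kappa>))"
      using \<open>\<kappa> > 0\<close> by (intro divide_right_mono) auto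
    finally show ?thesis .
  qed
  let ?y = "(Q ^^ (k * N)) x"
  \<comment> \<open>The intermediate point follows the flow through the incomplete block. The first
    distance is a single local error and accounts for the summand \<open>1\<close> in the constant;
    the second is \<open>blocks\<close> at \<open>t = \<delta> * real r\<close>.\<close>
  have "d ((Q ^^ l) x) (P (\<delta> * real l) x)
      \<le> d ((Q ^^ l) x) (P (\<delta> * real r) ?y) + d (P (\<delta> * real r) ?y) (P (\<delta> * real l) x)"
    using \<delta> orbit x by (intro triangle P_closed) auto
  also have "d ((Q ^^ l) x) (P (\<delta> * real r) ?y) \<le> \<epsilon>"
    using err[OF r, of "k * N"] by (simp add: l(2) funpow_add commute)
  also have "d (P (\<delta> * real r) ?y) (P (\<delta> * real l) x) \<le> max 1 C * \<epsilon> * (1 / (1 - exp (- \<kappa>)))"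
    unfolding time using \<delta> \<epsilon>
    by (intro order_trans[OF blocks] mult_left_mono geom) auto
  finally show ?thesis by (simp add: algebra_simps)
qed

section \<open>Kernels acting on laws, and the semigroup property\<close>

lemma act_in_prob_measures:
  assumes "\<nu> \<in> prob_measures" "markov_kernel K"
  shows "act \<nu> K \<in> prob_measures"
  using assms unfolding markov_kernel_def
  by (auto simp: space_prob_algebra intro!: prob_space_bind' sets_bind')

lemma measure_act:
  fixes A :: "'a::topological_space set"
  assumes "\<nu> \<in> prob_measures" "markov_kernel K" "A \<in> sets borel"
  shows "measure (act \<nu> K) A = (\<integral>x. measure (K x) A \<partial>\<nu>)"
proof -
  have \<nu>: "prob_space \<nu>" "sets \<nu> = sets borel"
    using assms by (auto simp: space_prob_algebra)
  have "K \<in> borel \<rightarrow>\<^sub>M subprob_algebra borel"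
    using assms(2) unfolding markov_kernel_def by (rule measurable_prob_algebraD)
  then have "K \<in> \<nu> \<rightarrow>\<^sub>M subprob_algebra borel"
    using \<nu> by simp
  then show ?thesis
    using \<nu> assms(3) prob_space_imp_subprob_space by (intro subprob_space.measure_bind) auto
qed

lemma subalgebra_natural_filtration:
  assumes "\<And>u. 0 \<le> u \<Longrightarrow> u \<le> s \<Longrightarrow> X u \<in> borel_measurable M"
  shows "subalgebra M (natural_filtration M X s)"
proof -
  have sub: "sets (vimage_algebra (space M) (X u) borel) \<subseteq> sets M" if "u \<in> {0..s}" for u
    using that assms by (auto simp: sets_vimage_algebra2 intro: measurable_sets)
  have "sets (natural_filtration M X s) \<subseteq> sets M"
    unfolding natural_filtration_def using sub sets.space_closed[of M]
    by (subst sets_measure_of) (blast intro!: sets.sigma_sets_subset)+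
  moreover have "space (natural_filtration M X s) = space M"
    unfolding natural_filtration_def by (simp add: space_measure_of_conv)
  ultimately show ?thesis
    unfolding subalgebra_def by simp
qed

text \<open>Averaging the Markov property over all outcomes removes the conditioning, since a
  conditional expectation has the same mean as the variable itself. What remains is an identity of
  laws.\<close>

lemma markov_process_distr:
  fixes X :: "real \<Rightarrow> 'w \<Rightarrow> 'a::topological_space"
  assumes "prob_space M" and X: "\<And>u. 0 \<le> u \<Longrightarrow> X u \<in> borel_measurable M"
    and "markov_process p M X" and K: "markov_kernel (p t)" and "0 \<le> s" "0 \<le> t"
  shows "act (distr M borel (X s)) (p t) = distr M borel (X (s + t))"
proof -
  interpret prob_space M by fact
  interpret finite_measure_subalgebra M "natural_filtration M X s"
    by unfold_locales (auto intro!: subalgebra_natural_filtration X)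
  have law: "distr M borel (X u) \<in> prob_measures" if "0 \<le> u" for u
    using X[OF that] by (auto simp: space_prob_algebra intro!: prob_space_distr)
  have "measure (act (distr M borel (X s)) (p t)) A = measure (distr M borel (X (s + t))) A"
    if A: "A \<in> sets borel" for A
  proof -
    let ?E = "\<lambda>\<omega>. real_cond_exp M (natural_filtration M X s) (\<lambda>\<omega>'. indicat_real A (X (s + t) \<omega>')) \<omega>"
    have [measurable]: "X s \<in> borel_measurable M" "X (s + t) \<in> borel_measurable M" "A \<in> sets borel"
      using X assms A by auto
    have [measurable]: "(\<lambda>x. measure (p t x) A) \<in> borel_measurable borel"
      using measurable_compose[OF measurable_prob_algebraD measurable_measure_subprob_algebra] K A
      unfolding markov_kernel_def by blast
    have "measure (act (distr M borel (X s)) (p t)) A = (\<integral>x. measure (p t x) A \<partial>distr M borel (X s))"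
      using law K A assms by (intro measure_act) auto
    also have "\<dots> = (\<integral>\<omega>. measure (p t (X s \<omega>)) A \<partial>M)"
      by (intro integral_distr) auto
    also have "\<dots> = (\<integral>\<omega>. ?E \<omega> \<partial>M)"
    proof (rule integral_cong_AE)
      have "AE \<omega> in M. ?E \<omega> = measure (p t (X s \<omega>)) A"
        using assms A unfolding markov_process_def by blast
      then show "AE \<omega> in M. measure (p t (X s \<omega>)) A = ?E \<omega>"
        by (rule AE_mp) auto
    qed auto
    also have "\<dots> = (\<integral>\<omega>. indicat_real A (X (s + t) \<omega>) \<partial>M)"
      by (intro real_cond_exp_int integrable_const_bound[where B=1]) auto
    also have "\<dots> = (\<integral>x. indicat_real A x \<partial>distr M borel (X (s + t)))"
      by (intro integral_distr[symmetric]) auto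
    also have "\<dots> = measure (distr M borel (X (s + t))) A"
      by simp
    finally show ?thesis .
  qed
  moreover have "act (distr M borel (X s)) (p t) \<in> prob_measures" "distr M borel (X (s + t)) \<in> prob_measures"
    using law K assms by (auto intro!: act_in_prob_measures)
  ultimately show ?thesis
    by (intro measure_eqI)
       (auto simp: space_prob_algebra finite_measure.emeasure_eq_measure prob_space.finite_measure)
qed

text \<open>Every law \<open>\<nu>\<close> has a solution started from it. There the Markov property
  at \<open>s = 0\<close> identifies \<open>act \<nu> (p t)\<close> with the law of
  \<open>X \<nu> t\<close>; at general \<open>s\<close> it then gives the composition rule.\<close>

lemma sde_transition_function_semigroup:
  assumes "sde_transition_function b \<sigma> M F B X p" "\<nu> \<in> prob_measures"
  shows "act \<nu> (p 0) = \<nu>"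
    and "0 \<le> s \<Longrightarrow> 0 \<le> t \<Longrightarrow> act (act \<nu> (p s)) (p t) = act \<nu> (p (s + t))"
proof -
  have sol: "sde_solution b \<sigma> (M \<nu>) (F \<nu>) (B \<nu>) (X \<nu>)" and X0: "distr (M \<nu>) borel (X \<nu> 0) = \<nu>"
    and markov: "markov_process p (M \<nu>) (X \<nu>)" and K: "\<And>t. 0 \<le> t \<Longrightarrow> markov_kernel (p t)"
    using assms unfolding sde_transition_function_def by auto
  have prob: "prob_space (M \<nu>)" and X: "X \<nu> u \<in> borel_measurable (M \<nu>)" if "0 \<le> u" for u
    using sol that measurable_from_subalg unfolding sde_solution_def filtered_prob_space_def continuous_adapted_def
    by blast+
  have law: "act \<nu> (p t) = distr (M \<nu>) borel (X \<nu> t)" if "0 \<le> t" for t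
    using markov_process_distr[where s=0, OF prob X markov K] that by (simp add: X0)
  show "act \<nu> (p 0) = \<nu>"
    by (simp add: law X0)
  show "act (act \<nu> (p s)) (p t) = act \<nu> (p (s + t))" if "0 \<le> s" "0 \<le> t"
    using markov_process_distr[OF prob X markov K] that by (simp add: law)
qed

section \<open>The error bound for the chain, uniform in time\<close>

theorem theorem3p1:
  shows "\<exists>\<Phi> :: real \<Rightarrow> real \<Rightarrow> real \<Rightarrow> real.
    \<forall>(b :: real ^ 'd \<Rightarrow> real ^ 'd) (\<sigma> :: real ^ 'd \<Rightarrow> real ^ 'd ^ 'd)
     (M :: (real ^ 'd) measure \<Rightarrow> 'w measure) F B X
     (p :: real \<Rightarrow> real ^ 'd \<Rightarrow> (real ^ 'd) measure)
     (\<pi> :: real \<Rightarrow> real ^ 'd \<Rightarrow> (real ^ 'd) measure)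
     (D :: (real ^ 'd) measure \<Rightarrow> (real ^ 'd) measure \<Rightarrow> real)
     (\<kappa> :: real) (C :: real) (\<alpha> :: real)
     (Mf :: (real ^ 'd) measure \<Rightarrow> real) (Cf :: (real ^ 'd) measure \<Rightarrow> real)
     (\<nu> :: (real ^ 'd) measure).
       sde_transition_function b \<sigma> M F B X p \<longrightarrow>
       (\<forall>\<delta>>0. markov_kernel (\<pi> \<delta>)) \<longrightarrow>
       Metric_space prob_measures D \<longrightarrow>
       \<kappa> > 0 \<longrightarrow> contractive D p \<kappa> C \<longrightarrow>
       \<alpha> > 0 \<longrightarrow> local_error_bound D p \<pi> \<alpha> Mf \<longrightarrow>
       uniform_control \<pi> Mf Cf \<longrightarrow>
       \<nu> \<in> prob_measures \<longrightarrow>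
       (\<forall>(l::nat) \<delta>. \<delta> > 0 \<and> inverse \<delta> \<in> \<nat> \<longrightarrow>
          D (chain_law (\<pi> \<delta>) l \<nu>) (act \<nu> (p (\<delta> * real l))) \<le> \<Phi> \<kappa> C (Cf \<nu>) * \<delta> powr \<alpha>)"
\<comment> \<open>The witness is the constant of the telescoping lemma times \<open>c\<close>, which
  stands for \<open>Cf \<nu>\<close>. It is fixed before any process, chain or distance is
  introduced, so it depends only on its three arguments.\<close>
proof (intro exI[of _ "\<lambda>\<kappa> C c. (1 + max 1 C / (1 - exp (- \<kappa>))) * c"] allI impI, elim conjE)
  fix b :: "real ^ 'd \<Rightarrow> real ^ 'd" and \<sigma> :: "real ^ 'd \<Rightarrow> real ^ 'd ^ 'd"
    and M :: "(real ^ 'd) measure \<Rightarrow> 'w measure" and F B X p \<pi> D Mf Cf and \<nu> :: "(real ^ 'd) measure"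
    and \<kappa> C \<alpha> \<delta> :: real and l :: nat
  assume p: "sde_transition_function b \<sigma> M F B X p"
    and \<pi>: "\<forall>\<delta>>0. markov_kernel (\<pi> \<delta>)"
    and metric: "Metric_space prob_measures D"
    and \<kappa>: "\<kappa> > 0" and contr: "contractive D p \<kappa> C"
    and err: "local_error_bound D p \<pi> \<alpha> Mf" and control: "uniform_control \<pi> Mf Cf"
    and \<nu>: "\<nu> \<in> prob_measures" and \<delta>: "\<delta> > 0" "inverse \<delta> \<in> \<nat>"
  interpret Metric_space prob_measures D by fact
  obtain N where "inverse \<delta> = real N"
    using \<delta>(2) by (auto elim: Nats_cases)
  with \<delta>(1) have N: "\<delta> * real N = 1"
    by (metis less_numeral_extra(3) right_inverse)
  have p_kernel: "markov_kernel (p t)" if "0 \<le> t" for t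
    using p that unfolding sde_transition_function_def by blast
  let ?Q = "\<lambda>\<mu>. act \<mu> (\<pi> \<delta>)"
  have orbit: "(?Q ^^ m) \<nu> \<in> prob_measures" for m
  proof (induction m)
    case (Suc m)
    then show ?case
      using \<pi> \<delta>(1) by (auto intro: act_in_prob_measures)
  qed (simp add: \<nu>)
  \<comment> \<open>The local error bound is applied with the chain law after \<open>m\<close> steps
    as initial law. \<open>uniform_control\<close> at \<open>\<nu>\<close> bounds its
    \<open>Mf\<close> by \<open>Cf \<nu>\<close> for every \<open>m\<close>, which makes the error
    uniform along the orbit; \<open>n \<le> N\<close> keeps the block within the window
    \<open>real n * \<delta> \<le> 1\<close>.\<close>
  have step: "D (act ((?Q ^^ m) \<nu>) (p (\<delta> * real n))) ((?Q ^^ n) ((?Q ^^ m) \<nu>)) \<le> \<delta> powr \<alpha> * Cf \<nu>"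
    if "n \<le> N" for m n
  proof -
    have "real n * \<delta> \<le> 1"
      using that N \<delta>(1) mult_left_mono[of "real n" "real N" \<delta>] by (simp add: mult.commute)
    then have "ereal (D (act ((?Q ^^ m) \<nu>) (p (\<delta> * real n))) (chain_law (\<pi> \<delta>) n ((?Q ^^ m) \<nu>)))
        \<le> (SUP n\<in>{n::nat. real n * \<delta> \<le> 1}.
            ereal (D (act ((?Q ^^ m) \<nu>) (p (\<delta> * real n))) (chain_law (\<pi> \<delta>) n ((?Q ^^ m) \<nu>))))"
      by (intro SUP_upper) simp
    also have "\<dots> \<le> ereal (\<delta> powr \<alpha> * Mf ((?Q ^^ m) \<nu>))"
      using err orbit \<delta>(1) unfolding local_error_bound_def by blast
    finally have "D (act ((?Q ^^ m) \<nu>) (p (\<delta> * real n))) ((?Q ^^ n) ((?Q ^^ m) \<nu>))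
        \<le> \<delta> powr \<alpha> * Mf ((?Q ^^ m) \<nu>)"
      by (simp add: chain_law_def)
    moreover have "ereal (Mf ((?Q ^^ m) \<nu>)) \<le> ereal (Cf \<nu>)"
      using control \<nu> \<delta>(1) unfolding uniform_control_def chain_law_def
      by (auto simp: SUP_le_iff)
    ultimately show ?thesis
      using mult_left_mono[of "Mf ((?Q ^^ m) \<nu>)" "Cf \<nu>" "\<delta> powr \<alpha>"] by simp
  qed
  \<comment> \<open>Laws are now the points of the metric space, and \<open>\<epsilon>\<close>
    becomes \<open>\<delta> powr \<alpha> * Cf \<nu>\<close>.\<close>
  have "D ((?Q ^^ l) \<nu>) (act \<nu> (p (\<delta> * real l)))
      \<le> (1 + max 1 C / (1 - exp (- \<kappa>))) * (\<delta> powr \<alpha> * Cf \<nu>)"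
  proof (rule telescoped_semigroup_error[where P="\<lambda>t \<mu>. act \<mu> (p t)" and N=N])
    show "D (act \<mu> (p t)) (act \<eta> (p t)) \<le> C * exp (- \<kappa> * t) * D \<mu> \<eta>"
      if "0 < t" "\<mu> \<in> prob_measures" "\<eta> \<in> prob_measures" for t \<mu> \<eta>
      using contr that unfolding contractive_def by blast
    show "act \<mu> (p t) \<in> prob_measures" if "0 \<le> t" "\<mu> \<in> prob_measures" for t \<mu>
      using that by (intro act_in_prob_measures p_kernel)
    show "act \<mu> (p 0) = \<mu>" if "\<mu> \<in> prob_measures" for \<mu>
      by (rule sde_transition_function_semigroup(1)[OF p that])
    show "act (act \<mu> (p s)) (p t) = act \<mu> (p (s + t))"
      if "0 \<le> s" "0 \<le> t" "\<mu> \<in> prob_measures" for s t \<mu>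
      by (rule sde_transition_function_semigroup(2)[OF p that(3,1,2)])
    show "act \<mu> (\<pi> \<delta>) \<in> prob_measures" if "\<mu> \<in> prob_measures" for \<mu>
      using that \<pi> \<delta> by (intro act_in_prob_measures) auto
    show "D (act ((?Q ^^ m) \<nu>) (p (\<delta> * real n))) ((?Q ^^ n) ((?Q ^^ m) \<nu>)) \<le> \<delta> powr \<alpha> * Cf \<nu>"
      if "n \<le> N" for m n
      by (rule step[OF that])
  qed fact+
  then show "D (chain_law (\<pi> \<delta>) l \<nu>) (act \<nu> (p (\<delta> * real l)))
      \<le> (1 + max 1 C / (1 - exp (- \<kappa>))) * Cf \<nu> * \<delta> powr \<alpha>"
    by (simp add: chain_law_def mult_ac)
qed

end
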